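(* Let $n$ be a positive natural number. An $n$-term syllogism (in the sense described in the context) is valid if and only if there is a (necessarily unique) syllogistic inference from (the concatenation of the Aristotelian diagrams of) its premisses to (the Aristotelian diagram of) its conclusion. Moreover, the number of valid $n$-term syllogisms is $3n^2-n$.
   Context: Categorical propositions on term-variables $X,Y$: $\mathbf{A}_{XY}$ "All $X$ is $Y$", $\mathbf{E}_{XY}$ "No $X$ is $Y$", $\mathbf{I}_{XY}$ "Some $X$ is $Y$", $\mathbf{O}_{XY}$ "Some $X$ is not $Y$" ($X$ is the subject, $Y$ the predicate). Interpreting term-variables as subsets of a set, these mean respectively $X\subseteq Y$, $X\cap Y=\emptyset$, $X\cap Y\neq\emptyset$, $X\not\subseteq Y$. The proposition $\mathbf{I}_{XX}$ ("Some $X$ is $X$", i.e. $X$ is inhabited) is called an assumption of existence; $\mathbf{A}_{XX}$ and $\mathbf{I}_{XX}$ are the laws of identity. An $n$-term syllogism involves exactly the $n$ term-variables $A_1,\dots,A_n$ and is written $\mathbf{X}_{A_{n-1}A_n},\mathbf{X}_{A_{n-2}A_{n-1}},\dots,\mathbf{X}_{A_1A_2}\models \mathbf{X}_{A_1A_n}$, where each $\mathbf{X}$ is one of $\mathbf{A},\mathbf{E},\mathbf{I},\mathbf{O}$ (not necessarily the same), each premise $\mathbf{X}_{A_iA_{i+1}}$ stands for either $\mathbf{X}_{A_iA_{i+1}}$ or $\mathbf{X}_{A_{i+1}A_i}$, and the premisses may additionally contain (explicitly mentioned) an assumption of existence $\mathbf{I}_{A_iA_i}$ for some $i$; the last proposition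 $\mathbf{X}_{A_1A_n}$ is the conclusion (for $n=1$ the premise and conclusion are propositions on $A_1,A_1$). Such a syllogism is valid if the truth of the premisses necessarily entails the truth of the conclusion; a syllogism containing an assumption of existence counts as a (valid) syllogism with assumption of existence when it is valid under that additional assumption. Aristotelian diagrams: $\mathbf{A}_{XY}$ is $X\to Y$; $\mathbf{E}_{XY}$ is $X\to\bullet\leftarrow Y$; $\mathbf{I}_{XY}$ is $X\leftarrow\bullet\to Y$; $\mathbf{O}_{XY}$ is $X\leftarrow\bullet\to\bullet\leftarrow Y$. Their duals $(\mathbf{X}_{XY})^{\circ}$ are the same diagrams read in the opposite direction, with $Y$ on the left: $Y\leftarrow X$, $Y\to\bullet\leftarrow X$, $Y\leftarrow\bullet\to X$, $Y\to\bullet\leftarrow\bullet\to X$. The premisses of an $n$-term syllogism are represented by diagrams or duals so that they can be concatenated (operation denoted $\sharp$, written right to left) into a single zigzag diagram from $A_1$ (leftmost) to $A_n$ (rightmost), an assumption of existence $\mathbf{I}_{A_iA_i}$ contributing $A_i\leftarrow\bullet\to A_i$. A syllogistic inference reduces such a concatenation by formally composing consecutive, equally oriented arrows separated by a single term-variable, thereby deleting that term-variable (bullets are never deleted). There is a syllogistic inference from the premisses to the conclusion if such reductions delete all term-variables other than the endpoints $A_1$, $A_n$ and yield exactly the Aristotelian diagram (not the dual) of the conclusion $\mathbf{X}_{A_1A_n}$.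
   Formalization: For n=1 the sole premise is taken to be a law of identity (A or I on A_1,A_1), and a syllogism with an assumption of existence counts as valid only if that assumption is needed for the entailment; validity is over subsets of any infinite set. *)

theory Defs
  imports Main
begin

text \<open>
  Categorical propositions. The term-variables are \<open>A\<^sub>1, A\<^sub>2, \<dots>\<close>; the natural number \<open>i\<close>
  stands for \<open>A\<^sub>i\<close>. In \<open>Prop X s p\<close>, the subject is \<open>s\<close> and the predicate is \<open>p\<close>.
\<close>

datatype cform = CA | CE | CI | CO

datatype cprop = Prop cform nat nat

fun holds :: "(nat \<Rightarrow> 'a set) \<Rightarrow> cprop \<Rightarrow> bool" where
  "holds v (Prop CA s p) \<longleftrightarrow> v s \<subseteq> v p"
| "holds v (Prop CE s p) \<longleftrightarrow> v s \<inter> v p = {}"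
| "holds v (Prop CI s p) \<longleftrightarrow> v s \<inter> v p \<noteq> {}"
| "holds v (Prop CO s p) \<longleftrightarrow> \<not> v s \<subseteq> v p"

text \<open>
  HOL cannot quantify over all sets of all types, hence the type argument. The ambient set whose
  subsets interpret the term-variables does not occur in the truth conditions, so it is left out.
\<close>

definition entails :: "'a itself \<Rightarrow> cprop set \<Rightarrow> cprop \<Rightarrow> bool" where
  "entails _ P c \<longleftrightarrow> (\<forall>v :: nat \<Rightarrow> 'a set. (\<forall>p\<in>P. holds v p) \<longrightarrow> holds v c)"

text \<open>
  Premisses are listed from the one on \<open>A\<^sub>1, A\<^sub>2\<close> to the one on \<open>A\<^bsub>n-1\<^esub>, A\<^sub>n\<close>. An assumption of
  existence for \<open>A\<^sub>i\<close> is listed between the premiss on \<open>A\<^bsub>i-1\<^esub>, A\<^sub>i\<close> and the one on \<open>A\<^sub>i, A\<^bsub>i+1\<^esub>\<close>.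
\<close>

definition existence :: "nat \<Rightarrow> cprop" where
  "existence i = Prop CI i i"

definition chain :: "nat \<Rightarrow> cprop list \<Rightarrow> bool" where
  "chain n cs \<longleftrightarrow> length cs = n - 1 \<and>
     (\<forall>i\<in>{1..<n}. \<exists>X. cs ! (i - 1) = Prop X i (i + 1) \<or> cs ! (i - 1) = Prop X (i + 1) i)"

text \<open>
  With a single term there is nothing to connect, and the one premiss is a law of identity: either
  \<open>Prop CA 1 1\<close> or (second disjunct, with empty \<open>cs\<close>) the assumption of existence \<open>Prop CI 1 1\<close>.
\<close>

definition premisses :: "nat \<Rightarrow> cprop list \<Rightarrow> bool" where
  "premisses n ps \<longleftrightarrow>
     (if n = 1 then ps = [Prop CA 1 1] else chain n ps) \<or>
     (\<exists>cs. \<exists>i\<in>{1..n}. chain n cs \<and> ps = take (i - 1) cs @ [existence i] @ drop (i - 1) cs)"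

definition syllogism :: "nat \<Rightarrow> cprop list \<Rightarrow> cprop \<Rightarrow> bool" where
  "syllogism n ps c \<longleftrightarrow> premisses n ps \<and> (\<exists>X. c = Prop X 1 n)"

text \<open>
  A syllogism with assumption of existence is one that becomes valid under that assumption: an
  assumption of existence which the entailment does not need is not admitted. Otherwise \<open>A\<^sub>1\<close> inhabited
  together with ``All \<open>A\<^sub>1\<close> is \<open>A\<^sub>2\<close>'' would be a second set of premisses for ``All \<open>A\<^sub>1\<close> is \<open>A\<^sub>2\<close>''.
\<close>

definition valid :: "'a itself \<Rightarrow> cprop list \<Rightarrow> cprop \<Rightarrow> bool" where
  "valid T ps c \<longleftrightarrow> entails T (set ps) c \<and>
     (\<forall>i. existence i \<in> set ps \<longrightarrow> \<not> entails T (set ps - {existence i}) c)"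

text \<open>
  A diagram is a zigzag read from left to right: its leftmost node, followed by the remaining nodes,
  each paired with the arrow that joins it to the node on its left.
\<close>

datatype node = Term nat | Bullet

datatype arrow = Rightward | Leftward

type_synonym diagram = "node \<times> (arrow \<times> node) list"

fun diagram :: "cprop \<Rightarrow> diagram" where
  "diagram (Prop CA s p) = (Term s, [(Rightward, Term p)])"
| "diagram (Prop CE s p) = (Term s, [(Rightward, Bullet), (Leftward, Term p)])"
| "diagram (Prop CI s p) = (Term s, [(Leftward, Bullet), (Rightward, Term p)])"
| "diagram (Prop CO s p) = (Term s, [(Leftward, Bullet), (Rightward, Bullet), (Leftward, Term p)])"

fun dual_diagram :: "cprop \<Rightarrow> diagram" where
  "dual_diagram (Prop CA s p) = (Term p, [(Leftward, Term s)])"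
| "dual_diagram (Prop CE s p) = (Term p, [(Rightward, Bullet), (Leftward, Term s)])"
| "dual_diagram (Prop CI s p) = (Term p, [(Leftward, Bullet), (Rightward, Term s)])"
| "dual_diagram (Prop CO s p) = (Term p, [(Rightward, Bullet), (Leftward, Bullet), (Rightward, Term s)])"

fun left_end :: "diagram \<Rightarrow> node" where
  "left_end (x, es) = x"

fun right_end :: "diagram \<Rightarrow> node" where
  "right_end (x, es) = (if es = [] then x else snd (last es))"

text \<open>
  Concatenation is written right to left and identifies the right end of \<open>D\<close> with the left end
  of \<open>E\<close>; it is only used when these two nodes agree.
\<close>

definition sharp :: "diagram \<Rightarrow> diagram \<Rightarrow> diagram"  (infixr "\<sharp>" 65) where
  "E \<sharp> D = (fst D, snd D @ snd E)"

inductive concatenation :: "cprop list \<Rightarrow> diagram \<Rightarrow> bool" where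
  single: "D \<in> {diagram p, dual_diagram p} \<Longrightarrow> concatenation [p] D"
| snoc: "concatenation ps D \<Longrightarrow> E \<in> {diagram p, dual_diagram p} \<Longrightarrow> left_end E = right_end D
    \<Longrightarrow> concatenation (ps @ [p]) (E \<sharp> D)"

text \<open>
  \<open>composes es S fs\<close>: the zigzag \<open>es\<close> is turned into \<open>fs\<close> by successively composing two equally
  oriented consecutive arrows separated by a term-variable. Each node carries a label naming its
  occurrence, and \<open>S\<close> collects the labels of the deleted occurrences. The leftmost node of the
  diagram is not part of the lists, so it is never deleted.
\<close>

inductive composes ::
  "(nat \<times> arrow \<times> node) list \<Rightarrow> nat set \<Rightarrow> (nat \<times> arrow \<times> node) list \<Rightarrow> bool" for es where
  refl: "composes es {} es"
| step: "composes es S (us @ (k, a, Term i) # (l, a, y) # vs)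
    \<Longrightarrow> composes es (insert k S) (us @ (l, a, y) # vs)"

text \<open>
  A syllogistic inference is identified by the concatenation \<open>D\<close> it starts from and the set \<open>S\<close> of
  occurrences of term-variables it deletes. The order of the deletions is not part of
  it, composition of arrows being associative.
\<close>

definition inference :: "nat \<Rightarrow> cprop list \<Rightarrow> cprop \<Rightarrow> diagram \<times> nat set \<Rightarrow> bool" where
  "inference n ps c = (\<lambda>(D, S). concatenation ps D \<and> left_end D = Term 1 \<and> right_end D = Term n \<and>
     (\<exists>fs. composes (enumerate 0 (snd D)) S fs \<and> diagram c = (left_end D, map snd fs)))"

end

theory Submission imports Defs begin

text \<open>
  Both sides of the equivalence are compared with explicit sets of premiss lists. On the syntactic
  side, the concatenation with left end \<open>A\<^sub>1\<close> is determined, deletions do not interfere with one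
  another, and all inner term-variables can be deleted iff the two arrows at each of them agree; so
  the surviving diagram can be read off premiss by premiss.

  On the semantic side, an entailment holds iff some particular proposition among the premisses and
  the contradictory of the conclusion has no witnessing point compatible with the universal ones.
  This is a satisfiability problem for one truth value per term, whose constraints form a chain (closed
  up by the contradictory of the conclusion when that is universal). Along a chain every value at one
  end can be continued to the other end, and a value is excluded at the far end only by unbroken runs
  of inclusions, with at most one exclusion in between.

  With \<open>m = n - 1\<close>, the valid premiss lists for the conclusions \<open>A\<close>, \<open>E\<close>, \<open>I\<close>, \<open>O\<close> number \<open>1\<close>, \<open>2m\<close>, \<open>3m + 1\<close>, \<open>3m\<^sup>2\<close>.
\<close>

section \<open>Valid premisses\<close>

fun ascent :: "nat \<Rightarrow> nat \<Rightarrow> cprop list" where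
  "ascent 0 a = []"
| "ascent (Suc m) a = Prop CA a (Suc a) # ascent m (Suc a)"

fun descent :: "nat \<Rightarrow> nat \<Rightarrow> cprop list" where
  "descent 0 a = []"
| "descent (Suc m) a = Prop CA (Suc a) a # descent m (Suc a)"

text \<open>The clauses peel off the leftmost premiss, so the count and both comparisons become
  inductions along the list. \<open>CO\<close> calls \<open>CE\<close> at the same \<open>m\<close>,
  because an assumption of existence does not advance the term; hence the extra weight for
  \<open>CO\<close> in the termination measure.\<close>

function moods :: "cform \<Rightarrow> nat \<Rightarrow> nat \<Rightarrow> cprop list set" where
  "moods CA m a = {ascent m a}"
| "moods CE 0 a = {}"
| "moods CE (Suc m) a =
     Cons (Prop CA a (Suc a)) ` moods CE m (Suc a) \<union>
     {Prop CE a (Suc a) # descent m (Suc a), Prop CE (Suc a) a # descent m (Suc a)}"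
| "moods CI 0 a = {[existence a]}"
| "moods CI (Suc m) a =
     Cons (Prop CA (Suc a) a) ` moods CI m (Suc a) \<union>
     {existence a # ascent (Suc m) a,
      Prop CI a (Suc a) # ascent m (Suc a), Prop CI (Suc a) a # ascent m (Suc a)}"
| "moods CO 0 a = {}"
| "moods CO (Suc m) a =
     Cons (Prop CA (Suc a) a) ` moods CO m (Suc a) \<union>
     {Prop CO a (Suc a) # descent m (Suc a)} \<union>
     Cons (existence a) ` moods CE (Suc m) a \<union>
     Cons (Prop CI a (Suc a)) ` moods CE m (Suc a) \<union>
     Cons (Prop CI (Suc a) a) ` moods CE m (Suc a)"
  by pat_completeness auto

termination
  by (relation "measure (\<lambda>(X, m, a). 2 * m + (if X = CO then 1 else 0))") auto

lemma card_Cons_image [simp]: "card (Cons x ` A) = card A"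
  by (simp add: card_image)

lemma finite_moods_CE [simp]: "finite (moods CE m a)"
  by (induction m arbitrary: a) auto

lemma finite_moods [simp]: "finite (moods X m a)"
  by (cases X; induction m arbitrary: a) auto

lemma card_moods_CE: "card (moods CE m a) = 2 * m"
proof (induction m arbitrary: a)
  case (Suc m)
  have "card (moods CE (Suc m) a) = card (moods CE m (Suc a)) + 2"
    unfolding moods.simps by (subst card_Un_disjoint) auto
  with Suc show ?case by simp
qed simp

lemma card_moods_CI: "card (moods CI m a) = 3 * m + 1"
proof (induction m arbitrary: a)
  case (Suc m)
  have "card (moods CI (Suc m) a) = card (moods CI m (Suc a)) + 3"
    unfolding moods.simps by (subst card_Un_disjoint) (auto simp: existence_def)
  with Suc show ?case by simp
qed simp

lemma card_moods_CO: "card (moods CO m a) = 3 * m\<^sup>2"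
proof (induction m arbitrary: a)
  case (Suc m)
  let ?A = "Cons (Prop CA (Suc a) a) ` moods CO m (Suc a)"
  let ?B = "{Prop CO a (Suc a) # descent m (Suc a)}"
  let ?C = "Cons (existence a) ` moods CE (Suc m) a"
  let ?D = "Cons (Prop CI a (Suc a)) ` moods CE m (Suc a)"
  let ?E = "Cons (Prop CI (Suc a) a) ` moods CE m (Suc a)"
  \<comment> \<open>The five pieces start with pairwise different propositions.\<close>
  have "(?A \<union> ?B \<union> ?C \<union> ?D) \<inter> ?E = {}" "(?A \<union> ?B \<union> ?C) \<inter> ?D = {}" "(?A \<union> ?B) \<inter> ?C = {}" "?A \<inter> ?B = {}"
    by (auto simp: existence_def simp del: moods.simps)
  then have "card (moods CO (Suc m) a) = card ?A + card ?B + card ?C + card ?D + card ?E"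
    unfolding moods.simps(7) by (simp only: card_Un_disjoint finite_Un finite_imageI finite_moods finite.intros)
  \<comment> \<open>The summands are \<open>3 * m\<^sup>2\<close>, \<open>1\<close>,
    \<open>2 * (m + 1)\<close>, \<open>2 * m\<close> and \<open>2 * m\<close>.\<close>
  also have "\<dots> = 3 * (Suc m)\<^sup>2"
    unfolding card_Cons_image by (simp add: Suc card_moods_CE power2_eq_square del: moods.simps)
  finally show ?case .
qed simp

section \<open>Chains of premisses on consecutive terms\<close>

definition connects :: "nat \<Rightarrow> cprop \<Rightarrow> bool" where
  "connects a p \<longleftrightarrow> (\<exists>X. p = Prop X a (Suc a) \<or> p = Prop X (Suc a) a)"

fun links :: "nat \<Rightarrow> cprop list \<Rightarrow> bool" where
  "links a [] \<longleftrightarrow> True"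
| "links a (p # cs) \<longleftrightarrow> connects a p \<and> links (Suc a) cs"

lemma connects_cases [consumes 1, case_names A A' E E' I I' O O']:
  assumes "connects a p"
  obtains "p = Prop CA a (Suc a)" | "p = Prop CA (Suc a) a"
    | "p = Prop CE a (Suc a)" | "p = Prop CE (Suc a) a"
    | "p = Prop CI a (Suc a)" | "p = Prop CI (Suc a) a"
    | "p = Prop CO a (Suc a)" | "p = Prop CO (Suc a) a"
  using assms unfolding connects_def by (metis cform.exhaust)

lemma connects_Prop [simp]: "connects a (Prop X a (Suc a))" "connects a (Prop X (Suc a) a)"
  by (auto simp: connects_def)

lemma links_append [simp]: "links a (us @ vs) \<longleftrightarrow> links a us \<and> links (a + length us) vs"
  by (induction us arbitrary: a) auto

lemma links_nth: "links a cs \<longleftrightarrow> (\<forall>k < length cs. connects (a + k) (cs ! k))"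
proof (induction cs arbitrary: a)
  case (Cons p cs)
  then show ?case by (auto simp: less_Suc_eq_0_disj)
qed simp

text \<open>A link joins two different terms, whereas an assumption of existence repeats one. This
  later makes the position of the assumption in a list recognizable.\<close>

lemma existence_not_in_links: "links a cs \<Longrightarrow> existence i \<notin> set cs"
  by (induction cs arbitrary: a) (auto simp: existence_def connects_def)

lemma length_ascent [simp]: "length (ascent m a) = m"
  by (induction m arbitrary: a) auto

lemma length_descent [simp]: "length (descent m a) = m"
  by (induction m arbitrary: a) auto

lemma links_ascent [simp]: "links a (ascent m a)"
  by (induction m arbitrary: a) auto

lemma links_descent [simp]: "links a (descent m a)"
  by (induction m arbitrary: a) auto

lemma moods_CE_links: "cs \<in> moods CE m a \<Longrightarrow> links a cs \<and> length cs = m"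
  by (induction m arbitrary: a cs) auto

section \<open>Explicit shapes of the valid premiss lists\<close>

lemma moods_step_descending:
  "ps \<in> moods X m (Suc a) \<Longrightarrow> X = CI \<or> X = CO \<Longrightarrow> Prop CA (Suc a) a # ps \<in> moods X (Suc m) a"
  by auto

lemma moods_CI_existence: "descent k a @ existence (a + k) # ascent l (a + k) \<in> moods CI (k + l) a"
proof (induction k arbitrary: a)
  case 0
  show ?case by (cases l) auto
next
  case (Suc k)
  show ?case using Suc[of "Suc a"] by simp
qed

lemma moods_CI_connected:
  assumes "e \<in> {Prop CI (a + k) (Suc (a + k)), Prop CI (Suc (a + k)) (a + k)}"
  shows "descent k a @ e # ascent l (Suc (a + k)) \<in> moods CI (Suc (k + l)) a"
  using assms
proof (induction k arbitrary: a)
  case (Suc k)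
  show ?case using Suc.IH[of "Suc a"] Suc.prems by (simp add: moods_step_descending del: moods.simps)
qed auto

lemma moods_CO_existence:
  assumes "vs \<in> moods CE l (a + k)"
  shows "descent k a @ existence (a + k) # vs \<in> moods CO (k + l) a"
  using assms
proof (induction k arbitrary: a)
  case 0
  then show ?case by (cases l) auto
next
  case (Suc k)
  show ?case using Suc.IH[of "Suc a"] Suc.prems by simp
qed

lemma moods_CO_connected:
  assumes "e \<in> {Prop CI (a + k) (Suc (a + k)), Prop CI (Suc (a + k)) (a + k)}"
    and "vs \<in> moods CE l (Suc (a + k))"
  shows "descent k a @ e # vs \<in> moods CO (Suc (k + l)) a"
  using assms
proof (induction k arbitrary: a)
  case (Suc k)
  show ?case using Suc.IH[of "Suc a"] Suc.prems by (simp add: moods_step_descending del: moods.simps)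
qed auto

lemma moods_CO_negative:
  "descent k a @ Prop CO (a + k) (Suc (a + k)) # descent l (Suc (a + k)) \<in> moods CO (Suc (k + l)) a"
proof (induction k arbitrary: a)
  case (Suc k)
  show ?case using Suc.IH[of "Suc a"] by (simp add: moods_step_descending del: moods.simps)
qed auto

text \<open>Unrolling the recursion turns its first clause into a descending run, which ends at a
  pivot: the particular premiss that supplies the witness. From there inclusions carry the witness
  up to the last term.\<close>

lemma moods_CI_cases:
  assumes "ps \<in> moods CI m a"
  obtains (existence) k l where "m = k + l" "ps = descent k a @ existence (a + k) # ascent l (a + k)"
  | (connected) k l e where "m = Suc (k + l)" "e \<in> {Prop CI (a + k) (Suc (a + k)), Prop CI (Suc (a + k)) (a + k)}"
      "ps = descent k a @ e # ascent l (Suc (a + k))"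
  using assms
proof (induction m arbitrary: a ps thesis)
  case 0
  show ?case by (rule "0.prems"(1)[of 0 0]) (use 0 in auto)
next
  case (Suc m)
  from Suc.prems(3) consider
      qs where "qs \<in> moods CI m (Suc a)" "ps = Prop CA (Suc a) a # qs"
    | "ps = existence a # ascent (Suc m) a"
    | e where "e \<in> {Prop CI a (Suc a), Prop CI (Suc a) a}" "ps = e # ascent m (Suc a)"
    by auto
  then show ?case
  proof cases
    case 1
    from 1(1) show ?thesis
    proof (rule Suc.IH[rotated 2])
      fix k l assume "m = k + l" "qs = descent k (Suc a) @ existence (Suc a + k) # ascent l (Suc a + k)"
      with 1 show thesis by (intro Suc.prems(1)[of "Suc k" l]) auto
    next
      fix k l e assume "m = Suc (k + l)" "qs = descent k (Suc a) @ e # ascent l (Suc (Suc a + k))"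
        "e \<in> {Prop CI (Suc a + k) (Suc (Suc a + k)), Prop CI (Suc (Suc a + k)) (Suc a + k)}"
      with 1 show thesis by (intro Suc.prems(2)[of "Suc k" l e]) auto
    qed
  next
    case 2
    then show thesis by (intro Suc.prems(1)[of 0 "Suc m"]) auto
  next
    case 3
    then show thesis by (intro Suc.prems(2)[of 0 m e]) auto
  qed
qed

text \<open>Behind a pivot of form \<open>CI\<close> the witness is kept out of the last term by a
  \<open>CE\<close> list. A pivot of form \<open>CO\<close> already places it outside the next term,
  and descending inclusions keep it outside.\<close>

lemma moods_CO_cases:
  assumes "ps \<in> moods CO m a"
  obtains (existence) k l vs where "m = k + l" "vs \<in> moods CE l (a + k)" "ps = descent k a @ existence (a + k) # vs"
  | (connected) k l e vs where "m = Suc (k + l)" "e \<in> {Prop CI (a + k) (Suc (a + k)), Prop CI (Suc (a + k)) (a + k)}"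
      "vs \<in> moods CE l (Suc (a + k))" "ps = descent k a @ e # vs"
  | (negative) k l where "m = Suc (k + l)"
      "ps = descent k a @ Prop CO (a + k) (Suc (a + k)) # descent l (Suc (a + k))"
  using assms
proof (induction m arbitrary: a ps thesis)
  case 0
  then show ?case by simp
next
  case (Suc m)
  from Suc.prems(4) consider
      qs where "qs \<in> moods CO m (Suc a)" "ps = Prop CA (Suc a) a # qs"
    | "ps = Prop CO a (Suc a) # descent m (Suc a)"
    | vs where "vs \<in> moods CE (Suc m) a" "ps = existence a # vs"
    | e vs where "e \<in> {Prop CI a (Suc a), Prop CI (Suc a) a}" "vs \<in> moods CE m (Suc a)" "ps = e # vs"
    unfolding moods.simps(7) by blast
  then show ?case
  proof cases
    case 1
    from 1(1) show ?thesis
    proof (rule Suc.IH[rotated 3])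
      fix k l vs assume "m = k + l" "vs \<in> moods CE l (Suc a + k)" "qs = descent k (Suc a) @ existence (Suc a + k) # vs"
      with 1 show thesis by (intro Suc.prems(1)[of "Suc k" l vs]) auto
    next
      fix k l e vs assume "m = Suc (k + l)" "vs \<in> moods CE l (Suc (Suc a + k))" "qs = descent k (Suc a) @ e # vs"
        "e \<in> {Prop CI (Suc a + k) (Suc (Suc a + k)), Prop CI (Suc (Suc a + k)) (Suc a + k)}"
      with 1 show thesis by (intro Suc.prems(2)[of "Suc k" l e vs]) auto
    next
      fix k l assume "m = Suc (k + l)"
        "qs = descent k (Suc a) @ Prop CO (Suc a + k) (Suc (Suc a + k)) # descent l (Suc (Suc a + k))"
      with 1 show thesis by (intro Suc.prems(3)[of "Suc k" l]) auto
    qed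
  next
    case 2
    then show thesis by (intro Suc.prems(3)[of 0 m]) auto
  next
    case 3
    then show thesis by (intro Suc.prems(1)[of 0 "Suc m" vs]) (auto simp del: moods.simps)
  next
    case 4
    then show thesis by (intro Suc.prems(2)[of 0 m e vs]) auto
  qed
qed

section \<open>Syllogistic inferences\<close>

fun path :: "nat \<Rightarrow> cprop list \<Rightarrow> bool" and dest :: "nat \<Rightarrow> cprop list \<Rightarrow> nat" where
  "path a [] \<longleftrightarrow> True"
| "path a (p # ps) \<longleftrightarrow> (if p = existence a then path a ps else connects a p \<and> path (Suc a) ps)"
| "dest a [] = a"
| "dest a (p # ps) = (if p = existence a then dest a ps else dest (Suc a) ps)"

lemma path_append [simp]: "path a (us @ vs) \<longleftrightarrow> path a us \<and> path (dest a us) vs"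
  by (induction us arbitrary: a) auto

lemma dest_append [simp]: "dest a (us @ vs) = dest (dest a us) vs"
  by (induction us arbitrary: a) auto

lemma dest_ge: "a \<le> dest a ps"
  by (induction ps arbitrary: a) (auto dest: Suc_leD)

lemma not_connects_existence [simp]: "\<not> connects a (existence i)"
  by (auto simp: connects_def existence_def)

lemma links_path: "links a cs \<Longrightarrow> path a cs \<and> dest a cs = a + length cs"
  by (induction cs arbitrary: a) auto

text \<open>The test selects the one of diagram and dual whose left end is the smaller term. For an
  assumption of existence the two coincide.\<close>

fun edges :: "cprop \<Rightarrow> (arrow \<times> node) list" where
  "edges (Prop X s p) = snd (if s \<le> p then diagram (Prop X s p) else dual_diagram (Prop X s p))"

definition word :: "cprop list \<Rightarrow> (arrow \<times> node) list" where
  "word ps = concat (map edges ps)"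

lemma word_simps [simp]: "word [] = []" "word (p # ps) = edges p @ word ps" "word (us @ vs) = word us @ word vs"
  by (auto simp: word_def)

lemma diagram_edges:
  assumes "D \<in> {diagram p, dual_diagram p}" "left_end D = Term a" "path a [p]"
  shows "D = (Term a, edges p)"
proof (cases "p = existence a")
  case True
  with assms show ?thesis by (auto simp: existence_def)
next
  case False
  with assms have "connects a p" by simp
  then show ?thesis using assms(1,2) by (cases rule: connects_cases) auto
qed

lemma edges_diagram: "path a [p] \<Longrightarrow> (Term a, edges p) \<in> {diagram p, dual_diagram p}"
proof (cases "p = existence a")
  case True
  then show ?thesis by (auto simp: existence_def)
next
  case False
  moreover assume "path a [p]"
  ultimately have "connects a p" by simp
  then show ?thesis by (cases rule: connects_cases) auto
qed

lemma last_edges: "path a [p] \<Longrightarrow> edges p \<noteq> [] \<and> snd (last (edges p)) = Term (dest a [p])"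
proof (cases "p = existence a")
  case True
  then show ?thesis by (auto simp: existence_def)
next
  case False
  moreover assume "path a [p]"
  ultimately have "connects a p" by simp
  then show ?thesis by (cases rule: connects_cases) (auto simp: existence_def)
qed

lemma right_end_word: "path a ps \<Longrightarrow> right_end (Term a, word ps) = Term (dest a ps)"
proof (cases ps rule: rev_cases)
  case (snoc qs p)
  moreover assume "path a ps"
  ultimately show ?thesis using last_edges[of "dest a qs" p] by (simp split: if_splits)
qed simp

text \<open>Induction from the right: the part already built ends in \<open>dest a ps\<close>, and
  diagram and dual of a link start at different terms, so matching ends leaves no choice for the
  next factor.\<close>

lemma concatenation_word:
  assumes "concatenation ps D" "left_end D = Term a" "path a ps"
  shows "D = (Term a, word ps)"
  using assms
proof (induction rule: concatenation.induct)
  case (single D p)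
  then show ?case using diagram_edges[of D p a] by simp
next
  case (snoc ps D E p)
  have "left_end D = Term a"
    using snoc.prems(1) by (cases D) (simp add: sharp_def)
  then have D: "D = (Term a, word ps)"
    using snoc by simp
  then have "left_end E = Term (dest a ps)"
    using snoc right_end_word by simp
  then have "E = (Term (dest a ps), edges p)"
    using diagram_edges snoc by simp
  with D show ?case by (simp add: sharp_def)
qed

lemma word_concatenation: "path a ps \<Longrightarrow> ps \<noteq> [] \<Longrightarrow> concatenation ps (Term a, word ps)"
proof (induction ps rule: rev_induct)
  case (snoc p ps)
  let ?E = "(Term (dest a ps), edges p)"
  have E: "?E \<in> {diagram p, dual_diagram p}"
    using snoc.prems by (intro edges_diagram) simp
  show ?case
  proof (cases "ps = []")
    case True
    with E show ?thesis by (auto intro: concatenation.single)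
  next
    case False
    with snoc have "concatenation ps (Term a, word ps)" by simp
    moreover have "left_end ?E = right_end (Term a, word ps)"
      using right_end_word snoc.prems by simp
    ultimately have "concatenation (ps @ [p]) (?E \<sharp> (Term a, word ps))"
      using E by (intro concatenation.snoc)
    then show ?thesis by (simp add: sharp_def)
  qed
qed simp

section \<open>Deletion of inner terms and its confluence\<close>

fun is_term :: "node \<Rightarrow> bool" where
  "is_term (Term i) \<longleftrightarrow> True"
| "is_term Bullet \<longleftrightarrow> False"

fun collapsible :: "(arrow \<times> node) list \<Rightarrow> bool" where
  "collapsible (x # y # es) \<longleftrightarrow> (is_term (snd x) \<longrightarrow> fst x = fst y) \<and> collapsible (y # es)"
| "collapsible es \<longleftrightarrow> True"

text \<open>The last entry always survives, being the right end of the zigzag. A general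
  \<open>P\<close> lets labelled and unlabelled words share one function.\<close>

fun drop_inner :: "('b \<Rightarrow> bool) \<Rightarrow> 'b list \<Rightarrow> 'b list" where
  "drop_inner P (x # y # es) = (if P x then drop_inner P (y # es) else x # drop_inner P (y # es))"
| "drop_inner P es = es"

lemma drop_inner_map: "drop_inner P (map f es) = map f (drop_inner (P \<circ> f) es)"
  by (induction "P \<circ> f" es rule: drop_inner.induct) auto

lemma drop_inner_nonempty [simp]: "drop_inner P es = [] \<longleftrightarrow> es = []"
  by (induction P es rule: drop_inner.induct) auto

lemma length_drop_inner: "length (drop_inner P es) \<le> length es"
  by (induction P es rule: drop_inner.induct) auto

lemma drop_inner_same_length: "length (drop_inner P es) = length es \<Longrightarrow> drop_inner P es = es"
proof (induction P es rule: drop_inner.induct)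
  case (1 P x y es)
  then show ?case using length_drop_inner[of P "y # es"] by (auto split: if_splits)
qed auto

text \<open>The condition removed is one that holds, and the surviving arrow has the same
  orientation, so the conditions at the neighbouring nodes are unchanged.\<close>

lemma collapsible_delete:
  assumes "is_term x"
  shows "collapsible (us @ (a, x) # (a, y) # vs) \<longleftrightarrow> collapsible (us @ (a, y) # vs)"
proof (induction us)
  case (Cons u us)
  then show ?case by (cases us) auto
qed (use assms in simp)

lemma drop_inner_delete:
  assumes "P x"
  shows "drop_inner P (us @ x # y # vs) = drop_inner P (us @ y # vs)"
proof (induction us)
  case (Cons u us)
  then show ?case by (cases us) auto
qed (use assms in simp)

definition reduct :: "(nat \<times> arrow \<times> node) list \<Rightarrow> (nat \<times> arrow \<times> node) list" where
  "reduct = drop_inner (is_term \<circ> snd \<circ> snd)"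

lemma reduct_simps [simp]:
  "reduct [] = []" "reduct [x] = [x]"
  "reduct (x # y # es) = (if is_term (snd (snd x)) then reduct (y # es) else x # reduct (y # es))"
  "reduct es = [] \<longleftrightarrow> es = []"
  by (simp_all add: reduct_def)

lemma reduct_delete: "reduct (us @ (k, a, Term i) # y # vs) = reduct (us @ y # vs)"
  unfolding reduct_def by (rule drop_inner_delete) simp

lemma map_snd_reduct: "map snd (reduct es) = drop_inner (is_term \<circ> snd) (map snd es)"
  unfolding reduct_def by (simp add: drop_inner_map comp_assoc)

text \<open>The invariants give uniqueness: the reduct is fixed throughout, and since labels are
  distinct, \<open>S\<close> can be recovered as the labels that disappeared.\<close>

lemma composes_invariants:
  assumes "composes es S fs" "distinct (map fst es)"
  shows "(collapsible (map snd es) \<longleftrightarrow> collapsible (map snd fs)) \<and> reduct es = reduct fs \<and>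
    distinct (map fst fs) \<and> S = fst ` set es - fst ` set fs \<and> fst ` set fs \<subseteq> fst ` set es"
  using assms
proof (induction rule: composes.induct)
  case (step S us k a i l y vs)
  then show ?case
    using collapsible_delete[of "Term i" "map snd us" a y "map snd vs"]
    by (auto simp: reduct_delete)
qed auto

lemma composes_Cons: "composes es S fs \<Longrightarrow> composes (e # es) S (e # fs)"
proof (induction rule: composes.induct)
  case refl
  show ?case by (rule composes.refl)
next
  case (step S us k a i l y vs)
  then show ?case using composes.step[of "e # es" S "e # us" k a i l y vs] by simp
qed

text \<open>Deleting from right to left reaches the full reduct. The second conjunct strengthens the
  induction: the first arrow keeps its orientation, so it can still be composed with the arrow
  before it.\<close>

lemma composes_reduct:
  assumes "collapsible (map snd es)"
  shows "(\<exists>S. composes es S (reduct es)) \<and> (es \<noteq> [] \<longrightarrow> fst (snd (hd (reduct es))) = fst (snd (hd es)))"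
  using assms
proof (induction es rule: induct_list012)
  case (3 x y es)
  obtain S where S: "composes (y # es) S (reduct (y # es))"
    and hd: "fst (snd (hd (reduct (y # es)))) = fst (snd y)"
    using 3 by auto
  have xS: "composes (x # y # es) S (x # reduct (y # es))"
    by (rule composes_Cons) (rule S)
  show ?case
  proof (cases "is_term (snd (snd x))")
    case True
    obtain k a i where x: "x = (k, a, Term i)"
      using True by (cases x; cases "snd (snd x)") auto
    obtain l b z vs where red: "reduct (y # es) = (l, b, z) # vs"
      by (cases "reduct (y # es)") auto
    have "fst (snd y) = a"
      using 3(3) x by auto
    with hd red have "b = a" by simp
    then have "composes (x # y # es) (insert k S) (reduct (y # es))"
      using composes.step[of "x # y # es" S "[]" k a i l z vs] xS x red by simp
    with True hd x \<open>fst (snd y) = a\<close> show ?thesis by auto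
  next
    case False
    with xS show ?thesis by auto
  qed
qed (auto intro: composes.refl)

lemma collapsible_drop_inner_diagram:
  "collapsible (snd (diagram c)) \<and> drop_inner (is_term \<circ> snd) (snd (diagram c)) = snd (diagram c)"
  by (cases c rule: diagram.cases) auto

text \<open>The diagram of a conclusion has no inner terms, so it equals its own reduct and can only
  be the reduct of the word. The left end determines \<open>D\<close>, and the missing labels
  determine \<open>S\<close>.\<close>

lemma inference_iff:
  assumes "path 1 ps" "dest 1 ps = n" "ps \<noteq> []"
  shows "inference n ps (Prop X 1 n) (D, S) \<longleftrightarrow>
    D = (Term 1, word ps) \<and> S = fst ` set (enumerate 0 (word ps)) - fst ` set (reduct (enumerate 0 (word ps))) \<and>
    collapsible (word ps) \<and> drop_inner (is_term \<circ> snd) (word ps) = snd (diagram (Prop X 1 n))"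
    (is "?L \<longleftrightarrow> ?R")
proof
  let ?es = "enumerate 0 (word ps)"
  have distinct: "distinct (map fst ?es)" by simp
  have labels: "map snd (reduct ?es) = drop_inner (is_term \<circ> snd) (word ps)"
    by (simp add: map_snd_reduct)
  {
    assume ?L
    then obtain fs where L: "concatenation ps D" "left_end D = Term 1"
      "composes (enumerate 0 (snd D)) S fs" "diagram (Prop X 1 n) = (left_end D, map snd fs)"
      by (auto simp: inference_def)
    then have D: "D = (Term 1, word ps)"
      using concatenation_word assms by blast
    have "composes ?es S fs"
      using L D by simp
    note inv = composes_invariants[OF this distinct]
    have "collapsible (map snd fs)" "drop_inner (is_term \<circ> snd) (map snd fs) = map snd fs"
      using collapsible_drop_inner_diagram[of "Prop X 1 n"] L(4) by auto
    then have "map snd (reduct fs) = map snd fs"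
      by (simp add: map_snd_reduct)
    \<comment> \<open>Equality is known only after forgetting labels, so it is lifted through
      lengths: a reduct as long as its argument has lost nothing.\<close>
    then have "length (reduct fs) = length fs"
      using map_eq_imp_length_eq by blast
    have "reduct fs = fs"
      using \<open>length (reduct fs) = length fs\<close> unfolding reduct_def by (rule drop_inner_same_length)
    then show ?R
      using inv D L(4) labels \<open>collapsible (map snd fs)\<close> by auto
  }
  assume R: ?R
  then obtain S' where S': "composes ?es S' (reduct ?es)"
    using composes_reduct[of ?es] by auto
  moreover have "S' = S"
    using composes_invariants[OF S' distinct] R by simp
  moreover have "diagram (Prop X 1 n) = (Term 1, map snd (reduct ?es))"
    using R labels by (cases X) auto
  ultimately show ?L
    using word_concatenation[of 1 ps] right_end_word[of 1 ps] assms R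
    unfolding inference_def by auto
qed

section \<open>Words that collapse to the diagram of a conclusion\<close>

definition collapses :: "(arrow \<times> node) list \<Rightarrow> (arrow \<times> node) list \<Rightarrow> bool" where
  "collapses es fs \<longleftrightarrow> collapsible es \<and> drop_inner (is_term \<circ> snd) es = fs"

lemma collapses_simps [simp]:
  "collapses [x] fs \<longleftrightarrow> fs = [x]"
  "collapses ((b, Term i) # (b', z) # es) fs \<longleftrightarrow> b = b' \<and> collapses ((b', z) # es) fs"
  "collapses ((b, Bullet) # y # es) [] \<longleftrightarrow> False"
  "collapses ((b, Bullet) # y # es) (f # fs) \<longleftrightarrow> f = (b, Bullet) \<and> collapses (y # es) fs"
  "collapses (y # es) [] \<longleftrightarrow> False"
  by (auto simp: collapses_def)

lemma path_Cons_cases [consumes 1, case_names existence A A' E E' I I' O O']: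
  assumes "path a (p # ps)"
  obtains "p = existence a" "path a ps" "dest a (p # ps) = dest a ps" "edges p = [(Leftward, Bullet), (Rightward, Term a)]"
  | "p = Prop CA a (Suc a)" "path (Suc a) ps" "dest a (p # ps) = dest (Suc a) ps"
  | "p = Prop CA (Suc a) a" "path (Suc a) ps" "dest a (p # ps) = dest (Suc a) ps"
  | "p = Prop CE a (Suc a)" "path (Suc a) ps" "dest a (p # ps) = dest (Suc a) ps"
  | "p = Prop CE (Suc a) a" "path (Suc a) ps" "dest a (p # ps) = dest (Suc a) ps"
  | "p = Prop CI a (Suc a)" "path (Suc a) ps" "dest a (p # ps) = dest (Suc a) ps"
  | "p = Prop CI (Suc a) a" "path (Suc a) ps" "dest a (p # ps) = dest (Suc a) ps"
  | "p = Prop CO a (Suc a)" "path (Suc a) ps" "dest a (p # ps) = dest (Suc a) ps"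
  | "p = Prop CO (Suc a) a" "path (Suc a) ps" "dest a (p # ps) = dest (Suc a) ps"
proof (cases "p = existence a")
  case True
  with assms show ?thesis by (intro that(1)) (auto simp: existence_def)
next
  case False
  with assms have p: "connects a p" "path (Suc a) ps" "dest a (p # ps) = dest (Suc a) ps" by auto
  from p(1) show ?thesis by (cases rule: connects_cases) (use p that in blast)+
qed

text \<open>Prefixing an arrow into \<open>A\<^sub>a\<close> makes the claims inductive: it stands for the part already composed.\<close>

lemma collapses_ascent:
  "path a ps \<Longrightarrow> dest a ps = a + m \<Longrightarrow>
    collapses ((Rightward, Term a) # word ps) [(Rightward, Term (a + m))] \<longleftrightarrow> ps = ascent m a"
proof (induction ps arbitrary: a m)
  case Nil
  then show ?case by simp
next
  case (Cons p ps)
  show ?case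
    using Cons.prems(1)
    by (cases rule: path_Cons_cases; cases m)
      (use Cons.IH[of "Suc a" "m - 1"] Cons.prems(2) dest_ge[of "Suc a" ps] in \<open>simp_all add: existence_def\<close>)
qed

lemma collapses_descent:
  "path a ps \<Longrightarrow> dest a ps = a + m \<Longrightarrow>
    collapses ((Leftward, Term a) # word ps) [(Leftward, Term (a + m))] \<longleftrightarrow> ps = descent m a"
proof (induction ps arbitrary: a m)
  case Nil
  then show ?case by simp
next
  case (Cons p ps)
  show ?case
    using Cons.prems(1)
    by (cases rule: path_Cons_cases; cases m)
      (use Cons.IH[of "Suc a" "m - 1"] Cons.prems(2) dest_ge[of "Suc a" ps] in \<open>simp_all add: existence_def\<close>)
qed

text \<open>Rightward inclusions are absorbed by the prefix until an exclusion supplies the bullet;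
  behind the bullet only a descent can collapse to a single leftward arrow.\<close>

lemma collapses_CE:
  "path a ps \<Longrightarrow> dest a ps = a + m \<Longrightarrow>
    collapses ((Rightward, Term a) # word ps) [(Rightward, Bullet), (Leftward, Term (a + m))] \<longleftrightarrow> ps \<in> moods CE m a"
proof (induction ps arbitrary: a m)
  case Nil
  then show ?case by simp
next
  case (Cons p ps)
  show ?case
    using Cons.prems(1)
    by (cases rule: path_Cons_cases; cases m)
      (use Cons.IH[of "Suc a" "m - 1"] Cons.prems(2) dest_ge[of "Suc a" ps]
         collapses_descent[of "Suc a" ps "m - 1"] in \<open>auto simp: existence_def\<close>)
qed

text \<open>The pivot supplies the bullet and turns the direction. An existence pivot does so
  without advancing the term, hence the instance of \<open>collapses_ascent\<close> at
  \<open>a\<close> and \<open>m\<close> besides the one at \<open>Suc a\<close>.\<close>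

lemma collapses_CI:
  "path a ps \<Longrightarrow> dest a ps = a + m \<Longrightarrow>
    collapses ((Leftward, Term a) # word ps) [(Leftward, Bullet), (Rightward, Term (a + m))] \<longleftrightarrow> ps \<in> moods CI m a"
proof (induction ps arbitrary: a m)
  case Nil
  then show ?case by simp
next
  case (Cons p ps)
  show ?case
    using Cons.prems(1)
    by (cases rule: path_Cons_cases; cases m)
      (use Cons.IH[of "Suc a" "m - 1"] Cons.prems(2) dest_ge[of "Suc a" ps]
         collapses_ascent[of "Suc a" ps "m - 1"] collapses_ascent[of a ps m] in \<open>auto simp: existence_def\<close>)
qed

lemma collapses_CO:
  "path a ps \<Longrightarrow> dest a ps = a + m \<Longrightarrow>
    collapses ((Leftward, Term a) # word ps) [(Leftward, Bullet), (Rightward, Bullet), (Leftward, Term (a + m))] \<longleftrightarrow>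
    ps \<in> moods CO m a"
proof (induction ps arbitrary: a m)
  case Nil
  then show ?case by simp
next
  case (Cons p ps)
  show ?case
    using Cons.prems(1)
    by (cases rule: path_Cons_cases; cases m)
      (use Cons.IH[of "Suc a" "m - 1"] Cons.prems(2) dest_ge[of "Suc a" ps]
         collapses_CE[of "Suc a" ps "m - 1"] collapses_descent[of "Suc a" ps "m - 1"] collapses_CE[of a ps m]
       in \<open>auto simp: existence_def\<close>)
qed

lemma collapses_diagram:
  assumes "path a ps" "dest a ps = a + m" "ps \<noteq> []"
  shows "collapses (word ps) (snd (diagram (Prop X a (a + m)))) \<longleftrightarrow> ps \<in> moods X m a"
proof -
  obtain b y es where w: "word ps = (b, y) # es"
    using assms(1,3) last_edges[of a "hd ps"] by (cases ps; cases "word ps") (auto split: if_splits)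
  \<comment> \<open>Composition preserves the direction of the first arrow. Each target diagram
    starts in the direction of the prefix used above, so the prefix can be stripped.\<close>
  have hd: "fs \<noteq> [] \<and> fst (hd fs) = b" if "collapses ((b, y) # es) fs" for fs
    using that by (induction es arbitrary: y fs) (case_tac y; auto simp: collapses_def split: if_splits)+
  have prefix: "collapses ((b', Term a) # word ps) ((b', z) # fs) \<longleftrightarrow> collapses (word ps) ((b', z) # fs)" for b' z fs
    using hd[of "(b', z) # fs"] w by auto
  show ?thesis
    using prefix collapses_ascent[OF assms(1,2)] collapses_CE[OF assms(1,2)] collapses_CI[OF assms(1,2)]
      collapses_CO[OF assms(1,2)]
    by (cases X) simp_all
qed

lemma inference_iff_moods:
  assumes "path 1 ps" "dest 1 ps = 1 + m" "ps \<noteq> []"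
  shows "(\<exists>J. inference (1 + m) ps (Prop X 1 (1 + m)) J) \<longleftrightarrow> ps \<in> moods X m 1"
    and "inference (1 + m) ps (Prop X 1 (1 + m)) J \<Longrightarrow> inference (1 + m) ps (Prop X 1 (1 + m)) J' \<Longrightarrow> J = J'"
proof -
  note iff = inference_iff[OF assms(1,2,3), where X = X]
  show "(\<exists>J. inference (1 + m) ps (Prop X 1 (1 + m)) J) \<longleftrightarrow> ps \<in> moods X m 1"
    using iff collapses_diagram[OF assms, of X] by (simp add: collapses_def)
  show "inference (1 + m) ps (Prop X 1 (1 + m)) J \<Longrightarrow> inference (1 + m) ps (Prop X 1 (1 + m)) J' \<Longrightarrow> J = J'"
    by (cases J; cases J') (simp only: iff)
qed

section \<open>Entailment\<close>

text \<open>A point of the ambient set is a truth assignment to the term-variables. Universal propositions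
  constrain every point; a particular one asks for one witnessing point.\<close>

fun admits :: "(nat \<Rightarrow> bool) \<Rightarrow> cprop \<Rightarrow> bool" where
  "admits t (Prop CA s p) \<longleftrightarrow> (t s \<longrightarrow> t p)"
| "admits t (Prop CE s p) \<longleftrightarrow> \<not> (t s \<and> t p)"
| "admits t (Prop CI s p) \<longleftrightarrow> True"
| "admits t (Prop CO s p) \<longleftrightarrow> True"

fun witnesses :: "(nat \<Rightarrow> bool) \<Rightarrow> cprop \<Rightarrow> bool" where
  "witnesses t (Prop CI s p) \<longleftrightarrow> t s \<and> t p"
| "witnesses t (Prop CO s p) \<longleftrightarrow> t s \<and> \<not> t p"
| "witnesses t (Prop CA s p) \<longleftrightarrow> True"
| "witnesses t (Prop CE s p) \<longleftrightarrow> True"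

fun contradictory :: "cprop \<Rightarrow> cprop" where
  "contradictory (Prop CA s p) = Prop CO s p"
| "contradictory (Prop CE s p) = Prop CI s p"
| "contradictory (Prop CI s p) = Prop CE s p"
| "contradictory (Prop CO s p) = Prop CA s p"

fun particular :: "cprop \<Rightarrow> bool" where
  "particular (Prop X s p) \<longleftrightarrow> X = CI \<or> X = CO"

lemma holds_contradictory: "holds v (contradictory c) \<longleftrightarrow> \<not> holds v c"
  by (cases c rule: contradictory.cases) auto

lemma holds_iff:
  "holds v p \<longleftrightarrow> (if particular p then \<exists>x. witnesses (\<lambda>i. x \<in> v i) p else \<forall>x. admits (\<lambda>i. x \<in> v i) p)"
  by (cases p rule: contradictory.cases) auto

lemma particular_admits [simp]: "particular p \<Longrightarrow> admits t p"
  by (cases p rule: contradictory.cases) auto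

text \<open>Points may be collected freely, so a set of propositions is unsatisfiable only if one of its particular
  members has no witness compatible with the universal ones.\<close>

lemma entails_iff_no_witness:
  assumes "infinite (UNIV :: 'a set)" "finite P"
  shows "entails TYPE('a) P c \<longleftrightarrow> (\<exists>q \<in> insert (contradictory c) P. particular q \<and>
    (\<nexists>t. witnesses t q \<and> (\<forall>p \<in> insert (contradictory c) P. admits t p)))"
  (is "_ \<longleftrightarrow> (\<exists>q \<in> ?Q. particular q \<and> (\<nexists>t. ?W q t))")
proof
  assume ent: "entails TYPE('a) P c"
  show "\<exists>q \<in> ?Q. particular q \<and> (\<nexists>t. ?W q t)"
  proof (rule ccontr)
    assume "\<not> (\<exists>q \<in> ?Q. particular q \<and> (\<nexists>t. ?W q t))"
    then obtain t where t: "\<And>q. q \<in> ?Q \<Longrightarrow> particular q \<Longrightarrow> ?W q (t q)"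
      by metis
    \<comment> \<open>Infinity of the type supplies a separate point for each proposition in
      \<open>?Q\<close>.\<close>
    obtain B :: "'a set" where "finite B" "card B = card ?Q"
      using assms(1) infinite_arbitrarily_large by blast
    then obtain g where g: "bij_betw g ?Q B"
      using assms(2) finite_same_card_bij by (metis finite_insert)
    \<comment> \<open>For particular \<open>q\<close>, the point \<open>g q\<close> realises the
      assignment \<open>t q\<close>; every other point lies in no term.\<close>
    define v where "v i = {g q | q. q \<in> ?Q \<and> particular q \<and> t q i}" for i
    have point: "(\<lambda>i. g q \<in> v i) = t q" if "q \<in> ?Q" "particular q" for q
    proof
      fix i
      have "q' = q" if "g q = g q'" "q' \<in> ?Q" for q'
        using g that \<open>q \<in> ?Q\<close> by (metis bij_betw_def inj_onD)
      then show "(g q \<in> v i) = t q i"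
        using that unfolding v_def by blast
    qed
    have no_point: "(\<lambda>i. x \<in> v i) = (\<lambda>i. False)" if "\<nexists>q. q \<in> ?Q \<and> particular q \<and> x = g q" for x
      using that unfolding v_def by blast
    have "holds v p" if "p \<in> ?Q" for p
    proof (cases "particular p")
      case True
      then have "witnesses (\<lambda>i. g p \<in> v i) p"
        using t that point by metis
      with True show ?thesis by (auto simp: holds_iff)
    next
      case False
      \<comment> \<open>Chosen points respect \<open>p\<close> by the choice of \<open>t\<close>; at
        all others every term is false, which no universal proposition forbids.\<close>
      have "admits (\<lambda>i. x \<in> v i) p" for x
      proof (cases "\<exists>q. q \<in> ?Q \<and> particular q \<and> x = g q")
        case True
        then show ?thesis using t that point by metis
      next
        case no: False
        show ?thesis unfolding no_point[OF no] using False by (cases p rule: contradictory.cases) auto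
      qed
      with False show ?thesis by (simp add: holds_iff)
    qed
    with ent holds_contradictory show False
      unfolding entails_def by (metis insert_iff)
  qed
next
  assume "\<exists>q \<in> ?Q. particular q \<and> (\<nexists>t. ?W q t)"
  then obtain q where q: "q \<in> ?Q" "particular q" "\<nexists>t. ?W q t" by blast
  show "entails TYPE('a) P c"
    unfolding entails_def
  proof (intro allI impI, rule ccontr)
    fix v :: "nat \<Rightarrow> 'a set"
    assume "\<forall>p \<in> P. holds v p" "\<not> holds v c"
    then have all: "\<forall>p \<in> ?Q. holds v p"
      using holds_contradictory by blast
    then obtain x where "witnesses (\<lambda>i. x \<in> v i) q"
      using q holds_iff by metis
    moreover have "admits (\<lambda>i. x \<in> v i) p" if "p \<in> ?Q" for p
      using all that holds_iff particular_admits by metis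
    ultimately show False using q(3) by blast
  qed
qed

section \<open>Truth values propagated along a chain\<close>

definition reach :: "nat \<Rightarrow> cprop list \<Rightarrow> bool \<Rightarrow> bool \<Rightarrow> bool" where
  "reach a cs x y \<longleftrightarrow> (\<exists>t. t a = x \<and> t (a + length cs) = y \<and> (\<forall>p \<in> set cs. admits t p))"

lemma admits_cong:
  assumes "\<And>i. a \<le> i \<Longrightarrow> i \<le> a + length cs \<Longrightarrow> t i = t' i" "links a cs" "p \<in> set cs"
  shows "admits t p \<longleftrightarrow> admits t' p"
  using assms
proof (induction cs arbitrary: a)
  case (Cons q cs)
  show ?case
  proof (cases "p = q")
    case True
    have "t a = t' a" "t (Suc a) = t' (Suc a)"
      using Cons.prems(1) by auto
    moreover have "connects a p"
      using Cons.prems True by simp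
    then show ?thesis
      by (cases rule: connects_cases) (simp_all add: calculation)
  next
    case False
    then show ?thesis
      using Cons.prems by (intro Cons.IH[of "Suc a"]) auto
  qed
qed simp

lemma reach_Nil [simp]: "reach a [] x y \<longleftrightarrow> x = y"
  by (auto simp: reach_def)

text \<open>The segments on both sides of a pivot can be assigned independently. They share a term
  if the pivot is an assumption of existence, and only then must their values agree.\<close>

lemma witness_iff_reach:
  assumes "links a us" "links c vs" "c = a + length us \<or> c = Suc (a + length us)"
  shows "(\<exists>t. t a = x \<and> t (a + length us) = z \<and> t c = w \<and> t (c + length vs) = y \<and>
      (\<forall>p \<in> set us \<union> set vs. admits t p)) \<longleftrightarrow>
    reach a us x z \<and> reach c vs w y \<and> (c = a + length us \<longrightarrow> z = w)"
proof
  assume "reach a us x z \<and> reach c vs w y \<and> (c = a + length us \<longrightarrow> z = w)"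
  then obtain t t' where t: "t a = x" "t (a + length us) = z" "\<forall>p \<in> set us. admits t p"
    and t': "t' c = w" "t' (c + length vs) = y" "\<forall>p \<in> set vs. admits t' p"
    and zw: "c = a + length us \<Longrightarrow> z = w"
    by (auto simp: reach_def)
  \<comment> \<open>Gluing: \<open>t\<close> up to the end of the first segment, \<open>t'\<close>
    beyond it; \<open>zw\<close> settles a shared term.\<close>
  let ?t = "\<lambda>i. if i \<le> a + length us then t i else t' i"
  have ge: "?t i = t' i" if "c \<le> i" for i
    using that assms(3) t t' zw by (cases "i = a + length us") auto
  have "admits ?t p" if "p \<in> set us" for p
    using admits_cong[of a us ?t t p] assms that t by simp
  moreover have "admits ?t p" if "p \<in> set vs" for p
    using admits_cong[of c vs ?t t' p] assms that t' ge by blast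
  moreover have "?t a = x" "?t (a + length us) = z" "?t c = w" "?t (c + length vs) = y"
    using t t' ge[of c] ge[of "c + length vs"] by simp_all
  ultimately show "\<exists>t. t a = x \<and> t (a + length us) = z \<and> t c = w \<and> t (c + length vs) = y \<and>
      (\<forall>p \<in> set us \<union> set vs. admits t p)"
    by (intro exI[of _ ?t]) blast
qed (auto simp: reach_def)

lemma reach_Cons:
  assumes "connects a p" "links (Suc a) cs"
  shows "reach a (p # cs) x y \<longleftrightarrow> (\<exists>z. admits (\<lambda>i. if i = a then x else z) p \<and> reach (Suc a) cs z y)"
proof -
  have p: "admits t p \<longleftrightarrow> admits (\<lambda>i. if i = a then t a else t (Suc a)) p" for t
    using assms(1) by (cases rule: connects_cases) simp_all
  have "reach a (p # cs) x y \<longleftrightarrow> (\<exists>z. admits (\<lambda>i. if i = a then x else z) p \<and>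
      (\<exists>t. t a = x \<and> t (Suc a) = z \<and> t (Suc a + length cs) = y \<and> (\<forall>p \<in> set cs. admits t p)))"
    (is "?L \<longleftrightarrow> ?R")
  proof
    assume ?L
    then obtain t where t: "t a = x" "t (Suc a + length cs) = y" "admits t p" "\<forall>p \<in> set cs. admits t p"
      by (auto simp: reach_def)
    then have "admits (\<lambda>i. if i = a then x else t (Suc a)) p"
      using p[of t] unfolding t(1) by blast
    with t show ?R by blast
  next
    assume ?R
    then obtain t where t: "t a = x" "t (Suc a + length cs) = y" "admits (\<lambda>i. if i = a then x else t (Suc a)) p"
        "\<forall>p \<in> set cs. admits t p"
      by blast
    then have "admits t p"
      using p[of t] unfolding t(1) by blast
    with t show ?L unfolding reach_def by (intro exI[of _ t]) simp
  qed
  \<comment> \<open>With an empty left segment, the value at \<open>a\<close> is independent of the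
    chain starting at \<open>Suc a\<close>.\<close>
  then show ?thesis
    using witness_iff_reach[of a "[]" "Suc a" cs x x] assms(2) by simp
qed

lemma reach_False: "reach a cs False False"
proof -
  have "admits (\<lambda>i. False) p" for p
    by (cases p rule: contradictory.cases) auto
  then show ?thesis unfolding reach_def by (intro exI[of _ "\<lambda>i. False"]) simp
qed

text \<open>Only end values matter, so a list acts as a relation on truth values, composed premiss
  by premiss. An inclusion or exclusion forbids one pair of values, a particular premiss
  none.\<close>

lemma reach_Cons_cases:
  assumes "links a (p # cs)"
  obtains "p = Prop CA a (Suc a)" "\<And>x y. reach a (p # cs) x y \<longleftrightarrow> reach (Suc a) cs True y \<or> \<not> x \<and> reach (Suc a) cs False y"
  | "p = Prop CA (Suc a) a" "\<And>x y. reach a (p # cs) x y \<longleftrightarrow> reach (Suc a) cs False y \<or> x \<and> reach (Suc a) cs True y"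
  | "p = Prop CE a (Suc a) \<or> p = Prop CE (Suc a) a"
      "\<And>x y. reach a (p # cs) x y \<longleftrightarrow> reach (Suc a) cs False y \<or> \<not> x \<and> reach (Suc a) cs True y"
  | X where "X = CI \<or> X = CO" "p = Prop X a (Suc a) \<or> p = Prop X (Suc a) a"
      "\<And>x y. reach a (p # cs) x y \<longleftrightarrow> reach (Suc a) cs False y \<or> reach (Suc a) cs True y"
proof -
  have p: "connects a p" "links (Suc a) cs" using assms by auto
  have C: "reach a (p # cs) x y \<longleftrightarrow>
      admits (\<lambda>i. if i = a then x else False) p \<and> reach (Suc a) cs False y \<or>
      admits (\<lambda>i. if i = a then x else True) p \<and> reach (Suc a) cs True y" for x y
    unfolding reach_Cons[OF p] ex_bool_eq by blast
  from p(1) show thesis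
  proof (cases rule: connects_cases)
    case A
    then show ?thesis using C by (intro that(1)) auto
  next
    case A'
    then show ?thesis using C by (intro that(2)) auto
  next
    case E
    then show ?thesis using C by (intro that(3)) auto
  next
    case E'
    then show ?thesis using C by (intro that(3)) auto
  next
    case I
    then show ?thesis using C by (intro that(4)[of CI]) auto
  next
    case I'
    then show ?thesis using C by (intro that(4)[of CI]) auto
  next
    case O
    then show ?thesis using C by (intro that(4)[of CO]) auto
  next
    case O'
    then show ?thesis using C by (intro that(4)[of CO]) auto
  qed
qed

text \<open>Together with \<open>reach_False\<close>: no value at either end is a dead end.\<close>

lemma reach_total:
  "links a cs \<Longrightarrow> (reach a cs True False \<or> reach a cs True True) \<and> (reach a cs False True \<or> reach a cs True True)"
proof (induction cs arbitrary: a)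
  case (Cons p cs)
  have "links (Suc a) cs" using Cons.prems by simp
  note IH = Cons.IH[OF this] reach_False[of "Suc a" cs]
  from Cons.prems show ?case
    by (cases rule: reach_Cons_cases) (use IH in auto)
qed simp

text \<open>The three claims need a simultaneous induction: after an initial exclusion, failing to
  get from true to true means that the tail fails to get from false to true.\<close>

lemma unreachable:
  assumes "links a cs" "length cs = m"
  shows "(\<not> reach a cs True False \<longleftrightarrow> cs = ascent m a) \<and>
    (\<not> reach a cs False True \<longleftrightarrow> cs = descent m a) \<and>
    (\<not> reach a cs True True \<longleftrightarrow> cs \<in> moods CE m a)"
  using assms
proof (induction cs arbitrary: a m)
  case (Cons p cs)
  then obtain m' where m: "m = Suc m'" "length cs = m'" by auto
  have l: "links (Suc a) cs" using Cons.prems by simp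
  note IH = Cons.IH[OF l m(2)] reach_total[OF l] reach_False[of "Suc a" cs]
  from Cons.prems(1) show ?case
    by (cases rule: reach_Cons_cases) (use IH m in auto)
qed auto

lemma reach_iff:
  assumes "links a cs"
  shows "reach a cs True False \<longleftrightarrow> cs \<noteq> ascent (length cs) a"
    and "reach a cs False True \<longleftrightarrow> cs \<noteq> descent (length cs) a"
    and "reach a cs True True \<longleftrightarrow> cs \<notin> moods CE (length cs) a"
  using unreachable[OF assms HOL.refl] by blast+

text \<open>The constraint that the contradictory of the conclusion puts on the two end values. For
  \<open>CA\<close> and \<open>CE\<close> that contradictory is particular and constrains no
  point.\<close>

fun refutes :: "cform \<Rightarrow> bool \<Rightarrow> bool \<Rightarrow> bool" where
  "refutes CI x y \<longleftrightarrow> \<not> (x \<and> y)"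
| "refutes CO x y \<longleftrightarrow> (x \<longrightarrow> y)"
| "refutes _ x y \<longleftrightarrow> True"

lemma admits_contradictory: "admits t (contradictory (Prop X a b)) \<longleftrightarrow> refutes X (t a) (t b)"
  by (cases X) auto

text \<open>A false left end refutes both \<open>CI\<close> and \<open>CO\<close>, so
  \<open>us\<close> must force it to be true, which takes a descent ending in a true
  \<open>z\<close>. The right end must then be forced to be true for \<open>CI\<close> and false for
  \<open>CO\<close>.\<close>

lemma no_refutation_iff:
  assumes "links a us" "links c vs"
  shows "(\<exists>x y. refutes X x y \<and> reach a us x z \<and> reach c vs w y) \<longleftrightarrow> \<not> (z \<and> us = descent (length us) a \<and>
    (X = CI \<and> w \<and> vs = ascent (length vs) c \<or>
     X = CO \<and> (if w then vs \<in> moods CE (length vs) c else vs = descent (length vs) c)))"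
  using reach_total[OF assms(1)] reach_total[OF assms(2)] reach_False[of a us] reach_False[of c vs]
    reach_iff[OF assms(1)] reach_iff[OF assms(2)]
  unfolding ex_bool_eq
  by (cases X; cases z; cases w; simp only: refutes.simps cform.distinct if_True if_False; blast)

section \<open>Which particular proposition forces the conclusion\<close>

definition forces :: "cprop set \<Rightarrow> cprop \<Rightarrow> cprop \<Rightarrow> bool" where
  "forces P e c \<longleftrightarrow> (\<nexists>t. witnesses t e \<and> (\<forall>p \<in> insert (contradictory c) P. admits t p))"

lemma forces_insert_particular: "particular e' \<Longrightarrow> forces (insert e' P) e c \<longleftrightarrow> forces P e c"
  by (auto simp: forces_def)

text \<open>The witness makes the shared term true, so both segments meet it with the value true in
  \<open>no_refutation_iff\<close>.\<close>

lemma forces_existence_iff: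
  assumes "links a (us @ vs)" "c = a + length us" "b = c + length vs"
  shows "forces (set (us @ vs)) (existence c) (Prop X a b) \<longleftrightarrow> us = descent (length us) a \<and>
    (X = CI \<and> vs = ascent (length vs) c \<or> X = CO \<and> vs \<in> moods CE (length vs) c)"
proof -
  have l: "links a us" "links c vs"
    using assms by auto
  have "(\<exists>x y. refutes X x y \<and> reach a us x True \<and> reach c vs True y) \<longleftrightarrow> (\<exists>x y. refutes X x y \<and>
      (\<exists>t. t a = x \<and> t c \<and> t b = y \<and> (\<forall>p \<in> set us \<union> set vs. admits t p)))"
    using witness_iff_reach[OF l, of _ True True] assms(2,3) by simp
  also have "\<dots> \<longleftrightarrow> (\<exists>t. t c \<and> refutes X (t a) (t b) \<and> (\<forall>p \<in> set us \<union> set vs. admits t p))"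
    by blast
  also have "\<dots> \<longleftrightarrow> \<not> forces (set (us @ vs)) (existence c) (Prop X a b)"
    by (simp add: forces_def admits_contradictory existence_def) blast
  finally show ?thesis
    using no_refutation_iff[OF l, of X True True] by auto
qed

text \<open>The witness fixes the values at \<open>c\<close> and \<open>Suc c\<close>: both true for
  \<open>CI\<close>, true and false for \<open>CO\<close>. The reversed \<open>CO\<close> makes
  \<open>c\<close> false and therefore never forces anything.\<close>

lemma forces_connected_iff:
  assumes "links a (us @ e # vs)" "c = a + length us" "b = Suc c + length vs" "particular e"
  shows "forces (set (us @ e # vs)) e (Prop X a b) \<longleftrightarrow> us = descent (length us) a \<and>
    (e \<in> {Prop CI c (Suc c), Prop CI (Suc c) c} \<and>
       (X = CI \<and> vs = ascent (length vs) (Suc c) \<or> X = CO \<and> vs \<in> moods CE (length vs) (Suc c)) \<or>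
     e = Prop CO c (Suc c) \<and> X = CO \<and> vs = descent (length vs) (Suc c))"
proof -
  have l: "links a us" "links (Suc c) vs" "connects c e"
    using assms by auto
  \<comment> \<open>\<open>W\<close> is the condition on the values at the two terms of
    \<open>e\<close>, so that all forms of pivot are treated at once.\<close>
  obtain W where W: "\<And>t. witnesses t e \<longleftrightarrow> W (t c) (t (Suc c))"
    and We: "e \<in> {Prop CI c (Suc c), Prop CI (Suc c) c} \<and> W = (\<lambda>z w. z \<and> w) \<or>
      e = Prop CO c (Suc c) \<and> W = (\<lambda>z w. z \<and> \<not> w) \<or> e = Prop CO (Suc c) c \<and> W = (\<lambda>z w. w \<and> \<not> z)"
    using l(3) assms(4) by (cases rule: connects_cases) fastforce+
  have "(\<exists>z w. W z w \<and> (\<exists>x y. refutes X x y \<and> reach a us x z \<and> reach (Suc c) vs w y)) \<longleftrightarrow>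
      (\<exists>z w. W z w \<and> (\<exists>x y. refutes X x y \<and>
        (\<exists>t. t a = x \<and> t c = z \<and> t (Suc c) = w \<and> t b = y \<and> (\<forall>p \<in> set us \<union> set vs. admits t p))))"
    using witness_iff_reach[OF l(1,2)] assms(2,3) by simp
  also have "\<dots> \<longleftrightarrow> (\<exists>t. W (t c) (t (Suc c)) \<and> refutes X (t a) (t b) \<and> (\<forall>p \<in> set us \<union> set vs. admits t p))"
    by blast
  also have "\<dots> \<longleftrightarrow> \<not> forces (set (us @ e # vs)) e (Prop X a b)"
    using assms(4) by (auto simp: forces_def admits_contradictory W)
  finally show ?thesis
    unfolding no_refutation_iff[OF l(1,2)] using We by (auto simp: ex_bool_eq)
qed

lemma entails_iff_forces:
  assumes "infinite (UNIV :: 'a set)" "finite P"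
  shows "entails TYPE('a) P c \<longleftrightarrow> (\<exists>e \<in> insert (contradictory c) P. particular e \<and> forces P e c)"
  unfolding entails_iff_no_witness[OF assms] forces_def ..

lemma forces_contradictory:
  assumes "links a cs" "b = a + length cs" "X = CA \<or> X = CE"
  shows "forces (set cs) (contradictory (Prop X a b)) (Prop X a b) \<longleftrightarrow> cs \<in> moods X (length cs) a"
proof -
  \<comment> \<open>A witness of the contradictory is true at \<open>a\<close>; at \<open>b\<close>
    it is true for \<open>CE\<close> and false for \<open>CA\<close>, which is the truth value of
    \<open>X = CE\<close>.\<close>
  have "\<not> forces (set cs) (contradictory (Prop X a b)) (Prop X a b) \<longleftrightarrow> reach a cs True (X = CE)"
    using assms(2,3) by (auto simp: forces_def reach_def)
  then show ?thesis using reach_iff[OF assms(1)] assms(3) by auto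
qed

text \<open>A universal conclusion can be forced only by its contradictory, a particular one only by
  a premiss serving as pivot.\<close>

lemma entails_links_iff:
  assumes "infinite (UNIV :: 'a set)" "links a cs" "b = a + length cs"
  shows "entails TYPE('a) (set cs) (Prop X a b) \<longleftrightarrow> cs \<in> moods X (length cs) a"
proof (cases "X = CA \<or> X = CE")
  case True
  have "\<not> forces (set cs) e (Prop X a b)" if e: "e \<in> set cs" "particular e" for e
  proof -
    obtain us vs where cs: "cs = us @ e # vs"
      using split_list[OF e(1)] by blast
    with True show ?thesis
      using forces_connected_iff[of a us e vs "a + length us" b X] assms(2,3) e(2) by auto
  qed
  then show ?thesis
    using True entails_iff_forces[OF assms(1), of "set cs" "Prop X a b"]
      forces_contradictory[OF assms(2,3), of X] by auto
next
  case X: False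
  \<comment> \<open>The contradictory is universal here, so the forcing proposition is among the
    premisses.\<close>
  then have "\<not> particular (contradictory (Prop X a b))"
    by (cases X) auto
  then have "entails TYPE('a) (set cs) (Prop X a b) \<longleftrightarrow> (\<exists>e \<in> set cs. particular e \<and> forces (set cs) e (Prop X a b))"
    using entails_iff_forces[OF assms(1), of "set cs" "Prop X a b"] by auto
  also have "\<dots> \<longleftrightarrow> cs \<in> moods X (length cs) a"
  proof
    assume "\<exists>e \<in> set cs. particular e \<and> forces (set cs) e (Prop X a b)"
    then obtain us e vs where cs: "cs = us @ e # vs" "particular e" "forces (set cs) e (Prop X a b)"
      using split_list by metis
    define c where "c = a + length us"
    have us: "us = descent (length us) a"
      and vs: "e \<in> {Prop CI c (Suc c), Prop CI (Suc c) c} \<and>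
         (X = CI \<and> vs = ascent (length vs) (Suc c) \<or> X = CO \<and> vs \<in> moods CE (length vs) (Suc c)) \<or>
       e = Prop CO c (Suc c) \<and> X = CO \<and> vs = descent (length vs) (Suc c)"
      using forces_connected_iff[of a us e vs c b X] assms(2,3) cs c_def by auto
    then show "cs \<in> moods X (length cs) a"
      using moods_CI_connected[of e a "length us" "length vs"] moods_CO_connected[of e a "length us" vs "length vs"]
        moods_CO_negative[of "length us" a "length vs"]
      unfolding cs(1) c_def by (auto simp del: moods.simps)
  next
    assume cs: "cs \<in> moods X (length cs) a"
    note notin = existence_not_in_links[OF assms(2)]
    consider "X = CI" | "X = CO" using X by (cases X) auto
    then obtain us e vs c where e: "cs = us @ e # vs" "c = a + length us" "us = descent (length us) a" "particular e"
        "e \<in> {Prop CI c (Suc c), Prop CI (Suc c) c} \<and>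
         (X = CI \<and> vs = ascent (length vs) (Suc c) \<or> X = CO \<and> vs \<in> moods CE (length vs) (Suc c)) \<or>
         e = Prop CO c (Suc c) \<and> X = CO \<and> vs = descent (length vs) (Suc c)"
    proof cases
      case 1
      from cs[unfolded 1] show ?thesis
      proof (cases rule: moods_CI_cases)
        case (existence k l)
        with notin show ?thesis by auto
      next
        case (connected k l e)
        with 1 show ?thesis by (intro that[of "descent k a" e "ascent l (Suc (a + k))" "a + k"]) auto
      qed
    next
      case 2
      from cs[unfolded 2] show ?thesis
      proof (cases rule: moods_CO_cases)
        case (existence k l vs)
        with notin show ?thesis by auto
      next
        case (connected k l e vs)
        with 2 show ?thesis using moods_CE_links by (intro that[of "descent k a" e vs "a + k"]) auto
      next
        case (negative k l)
        with 2 show ?thesis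
          by (intro that[of "descent k a" "Prop CO (a + k) (Suc (a + k))" "descent l (Suc (a + k))" "a + k"]) auto
      qed
    qed
    then have "forces (set cs) e (Prop X a b)"
      using forces_connected_iff[of a us e vs c b X] assms(2,3) by auto
    with e show "\<exists>e \<in> set cs. particular e \<and> forces (set cs) e (Prop X a b)" by auto
  qed
  finally show ?thesis .
qed

section \<open>Validity with an assumption of existence\<close>

lemma particular_existence [simp]: "particular (existence i)"
  by (simp add: existence_def)

lemma existence_eq_iff [simp]: "existence i = existence j \<longleftrightarrow> i = j"
  by (simp add: existence_def)

lemma not_particular_moods:
  "e \<in> set (ascent m a) \<Longrightarrow> \<not> particular e"
  "e \<in> set (descent m a) \<Longrightarrow> \<not> particular e"
  "cs \<in> moods CE m a \<Longrightarrow> e \<in> set cs \<Longrightarrow> \<not> particular e"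
proof -
  show up: "e \<in> set (ascent m a) \<Longrightarrow> \<not> particular e" for m a
    by (induction m arbitrary: a) auto
  show down: "e \<in> set (descent m a) \<Longrightarrow> \<not> particular e" for m a
    by (induction m arbitrary: a) auto
  show "cs \<in> moods CE m a \<Longrightarrow> e \<in> set cs \<Longrightarrow> \<not> particular e"
    by (induction m arbitrary: a cs) (auto dest: down)
qed

lemma particular_moods: "ps \<in> moods X m a \<Longrightarrow> X = CI \<or> X = CO \<Longrightarrow> \<exists>e \<in> set ps. particular e"
  by (elim disjE) (auto elim!: moods_CI_cases moods_CO_cases)

lemma moods_cases:
  assumes "ps \<in> moods X m a"
  obtains (links) "links a ps" "length ps = m"
  | (existence) us vs c where "ps = us @ existence c # vs" "c = a + length us" "links a (us @ vs)"
      "length us + length vs = m" "us = descent (length us) a"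
      "X = CI \<and> vs = ascent (length vs) c \<or> X = CO \<and> vs \<in> moods CE (length vs) c"
proof (cases X)
  case CA
  with assms show ?thesis by (intro that(1)) auto
next
  case CE
  with assms moods_CE_links show ?thesis by (intro that(1)) auto
next
  case CI
  from assms[unfolded CI] show ?thesis
  proof (cases rule: moods_CI_cases)
    case (existence k l)
    with CI show ?thesis by (intro that(2)[of "descent k a" "a + k" "ascent l (a + k)"]) auto
  next
    case (connected k l e)
    then show ?thesis by (intro that(1)) auto
  qed
next
  case CO
  from assms[unfolded CO] show ?thesis
  proof (cases rule: moods_CO_cases)
    case (existence k l vs)
    with CO show ?thesis using moods_CE_links by (intro that(2)[of "descent k a" "a + k" vs]) auto
  next
    case (connected k l e vs)
    then show ?thesis using moods_CE_links by (intro that(1)) auto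
  next
    case (negative k l)
    then show ?thesis by (intro that(1)) auto
  qed
qed

lemma valid_links_iff:
  assumes "infinite (UNIV :: 'a set)" "links a cs" "b = a + length cs"
  shows "valid TYPE('a) cs (Prop X a b) \<longleftrightarrow> cs \<in> moods X (length cs) a"
  using entails_links_iff[OF assms] existence_not_in_links[OF assms(2)] by (auto simp: valid_def)

text \<open>If the assumption forces the conclusion, all other premisses are universal; these entail
  no particular conclusion, so the assumption is indispensable as \<open>valid\<close>
  demands.\<close>

lemma valid_existence_iff:
  assumes inf: "infinite (UNIV :: 'a set)" and l: "links a (us @ vs)" and c: "c = a + length us" and b: "b = c + length vs"
  shows "valid TYPE('a) (us @ existence c # vs) (Prop X a b) \<longleftrightarrow>
    us @ existence c # vs \<in> moods X (length us + length vs) a"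
proof -
  let ?cs = "us @ vs" and ?ps = "us @ existence c # vs" and ?c = "Prop X a b"
  have notin: "existence i \<notin> set us" "existence i \<notin> set vs" for i
    using existence_not_in_links[OF l, of i] by auto
  have set: "set ?ps = insert (existence c) (set ?cs)" "set ?ps - {existence c} = set ?cs"
    using notin by auto
  have "entails TYPE('a) (set ?ps) ?c \<longleftrightarrow> entails TYPE('a) (set ?cs) ?c \<or> forces (set ?cs) (existence c) ?c"
    unfolding set(1) by (auto simp: entails_iff_forces[OF inf] forces_insert_particular)
  moreover have "existence i \<in> set ?ps \<longleftrightarrow> i = c" for i
    using notin by auto
  ultimately have "valid TYPE('a) ?ps ?c \<longleftrightarrow> forces (set ?cs) (existence c) ?c \<and> \<not> entails TYPE('a) (set ?cs) ?c"
    unfolding valid_def using set(2) by auto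
  also have "\<dots> \<longleftrightarrow> forces (set ?cs) (existence c) ?c"
  proof -
    have "\<not> entails TYPE('a) (set ?cs) ?c" if "forces (set ?cs) (existence c) ?c"
    proof -
      from that have X: "X = CI \<or> X = CO" and us: "us = descent (length us) a"
        and vs: "vs = ascent (length vs) c \<or> vs \<in> moods CE (length vs) c"
        using forces_existence_iff[OF l c b] by blast+
      have "\<not> particular e" if "e \<in> set ?cs" for e
        using that us vs not_particular_moods by (metis Un_iff set_append)
      then show ?thesis
        using entails_links_iff[OF inf l, of b X] particular_moods[of ?cs X "length ?cs" a] X c b by auto
    qed
    then show ?thesis by blast
  qed
  also have "\<dots> \<longleftrightarrow> us = descent (length us) a \<and> (X = CI \<and> vs = ascent (length vs) c \<or> X = CO \<and> vs \<in> moods CE (length vs) c)"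
    by (rule forces_existence_iff[OF l c b])
  also have "\<dots> \<longleftrightarrow> ?ps \<in> moods X (length us + length vs) a" (is "?R \<longleftrightarrow> ?M")
  proof
    assume ?R
    then show ?M
      using moods_CI_existence[of "length us" a "length vs"] moods_CO_existence[of vs "length vs" a "length us"] c
      by metis
  next
    assume ?M
    then show ?R
    proof (cases rule: moods_cases)
      case links
      then show ?thesis using existence_not_in_links[of a ?ps c] by auto
    next
      case (existence us' vs' c')
      have "existence c' \<in> set ?ps" unfolding existence(1) by simp
      then have "c' = c" using notin by auto
      moreover have "existence c \<notin> set us'"
        using existence_not_in_links[OF existence(3), of c] by auto
      \<comment> \<open>The assumption occurs only once, so the list splits around it in only one
        way.\<close>
      ultimately have "us = us' \<and> vs = vs'"
        using existence(1) notin append_Cons_eq_iff[of "existence c" us vs us' vs'] by auto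
      with existence \<open>c' = c\<close> show ?thesis by blast
    qed
  qed
  finally show ?thesis .
qed

section \<open>Premisses of syllogisms in terms of links\<close>

lemma chain_iff: "1 \<le> n \<Longrightarrow> chain n cs \<longleftrightarrow> length cs = n - 1 \<and> links 1 cs"
proof -
  assume n: "1 \<le> n"
  have "(\<forall>i \<in> {1..<n}. connects i (cs ! (i - 1))) \<longleftrightarrow> (\<forall>k < n - 1. connects (1 + k) (cs ! k))"
  proof (intro iffI allI impI ballI)
    fix k assume "\<forall>i \<in> {1..<n}. connects i (cs ! (i - 1))" "k < n - 1"
    then show "connects (1 + k) (cs ! k)" by (auto dest: bspec[of _ _ "1 + k"])
  next
    fix i assume "\<forall>k < n - 1. connects (1 + k) (cs ! k)" "i \<in> {1..<n}"
    then show "connects i (cs ! (i - 1))" by (auto dest: spec[of _ "i - 1"])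
  qed
  then show ?thesis
    unfolding chain_def links_nth by (auto simp: connects_def)
qed

lemma premisses_iff:
  assumes "1 \<le> n"
  shows "premisses n ps \<longleftrightarrow> (if n = 1 then ps = [Prop CA 1 1] else length ps = n - 1 \<and> links 1 ps) \<or>
    (\<exists>us vs. ps = us @ existence (1 + length us) # vs \<and> links 1 (us @ vs) \<and> length us + length vs = n - 1)"
proof -
  have "(\<exists>cs. \<exists>i \<in> {1..n}. chain n cs \<and> ps = take (i - 1) cs @ [existence i] @ drop (i - 1) cs) \<longleftrightarrow>
    (\<exists>us vs. ps = us @ existence (1 + length us) # vs \<and> links 1 (us @ vs) \<and> length us + length vs = n - 1)"
    (is "?L \<longleftrightarrow> ?R")
  proof
    assume ?L
    then obtain cs i where "i \<in> {1..n}" "length cs = n - 1" "links 1 cs"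
      "ps = take (i - 1) cs @ [existence i] @ drop (i - 1) cs"
      by (auto simp: chain_iff[OF assms])
    then show ?R
      by (intro exI[of _ "take (i - 1) cs"] exI[of _ "drop (i - 1) cs"]) (auto simp flip: links_append simp: min_def)
  next
    assume ?R
    then obtain us vs where "ps = us @ existence (1 + length us) # vs" "links 1 (us @ vs)" "length us + length vs = n - 1"
      by blast
    then show ?L
      using assms by (intro exI[of _ "us @ vs"] bexI[of _ "1 + length us"]) (auto simp: chain_iff[OF assms])
  qed
  then show ?thesis
    unfolding premisses_def by (simp add: chain_iff[OF assms])
qed

lemma premisses_identity:
  assumes "premisses n [Prop CA 1 1]" "1 \<le> n"
  shows "n = 1"
proof (rule ccontr)
  assume "n \<noteq> 1"
  moreover have "\<not> links 1 [Prop CA 1 1]"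
    by (simp add: connects_def)
  ultimately obtain c where "existence c \<in> set [Prop CA 1 1]"
    using assms(1) unfolding premisses_iff[OF assms(2)] by (metis in_set_conv_decomp)
  then show False
    by (simp add: existence_def)
qed

text \<open>The bound \<open>2 \<le> n\<close> matters: \<open>moods CA 0 1\<close> contains the
  empty list, which is not a premiss list for one term.\<close>

lemma moods_premisses:
  assumes "ps \<in> moods X (n - 1) 1" "2 \<le> n"
  shows "premisses n ps"
  using assms(1)
  by (cases rule: moods_cases) (use assms(2) in \<open>auto simp: premisses_iff\<close>)

text \<open>The law of identity is excluded because its diagram and its dual have the same left end, so that
  the concatenation is not determined by its left end.\<close>

lemma syllogism_iff_moods:
  assumes "infinite (UNIV :: 'a set)" "1 \<le> n" "premisses n ps" "ps \<noteq> [Prop CA 1 1]"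
  shows "valid TYPE('a) ps (Prop X 1 n) \<longleftrightarrow> ps \<in> moods X (n - 1) 1"
    and "(\<exists>J. inference n ps (Prop X 1 n) J) \<longleftrightarrow> ps \<in> moods X (n - 1) 1"
    and "inference n ps (Prop X 1 n) J \<Longrightarrow> inference n ps (Prop X 1 n) J' \<Longrightarrow> J = J'"
proof -
  have ps: "(valid TYPE('a) ps (Prop X 1 n) \<longleftrightarrow> ps \<in> moods X (n - 1) 1) \<and> path 1 ps \<and> dest 1 ps = n \<and> ps \<noteq> []"
    using assms(3)[unfolded premisses_iff[OF assms(2)]]
  proof
    assume "if n = 1 then ps = [Prop CA 1 1] else length ps = n - 1 \<and> links 1 ps"
    with assms(4) have "n \<noteq> 1" "length ps = n - 1" "links 1 ps" by (auto split: if_splits)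
    then show ?thesis
      using valid_links_iff[OF assms(1), of 1 ps n X] links_path[of 1 ps] assms(2) by auto
  next
    assume "\<exists>us vs. ps = us @ existence (1 + length us) # vs \<and> links 1 (us @ vs) \<and> length us + length vs = n - 1"
    then obtain us vs where *: "ps = us @ existence (1 + length us) # vs" "links 1 (us @ vs)" "length us + length vs = n - 1"
      by blast
    then show ?thesis
      using valid_existence_iff[OF assms(1) *(2) HOL.refl, of n X] links_path[of 1 us]
        links_path[of "1 + length us" vs] assms(2) by auto
  qed
  have n: "n = 1 + (n - 1)" using assms(2) by simp
  show "valid TYPE('a) ps (Prop X 1 n) \<longleftrightarrow> ps \<in> moods X (n - 1) 1"
    using ps by blast
  show "(\<exists>J. inference n ps (Prop X 1 n) J) \<longleftrightarrow> ps \<in> moods X (n - 1) 1"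
    using inference_iff_moods(1)[of ps "n - 1" X] ps n by simp
  show "inference n ps (Prop X 1 n) J \<Longrightarrow> inference n ps (Prop X 1 n) J' \<Longrightarrow> J = J'"
    using inference_iff_moods(2)[of ps "n - 1" X J J'] ps n by simp
qed

lemma valid_identity_iff: "valid TYPE('a) [Prop CA 1 1] (Prop X 1 1) \<longleftrightarrow> X = CA"
proof
  assume "valid TYPE('a) [Prop CA 1 1] (Prop X 1 1)"
  \<comment> \<open>The valuation with empty terms rules out \<open>CI\<close>, the one with full
    terms rules out \<open>CE\<close>, and either rules out \<open>CO\<close>.\<close>
  then have *: "holds (\<lambda>_. {} :: 'a set) (Prop X 1 1)" "holds (\<lambda>_. UNIV :: 'a set) (Prop X 1 1)"
    by (auto simp: valid_def entails_def)
  then show "X = CA" by (cases X) auto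
qed (auto simp: valid_def entails_def existence_def)

lemma concatenation_not_Nil: "\<not> concatenation [] D"
  by (auto elim: concatenation.cases)

text \<open>Both the diagram and its dual run from the term to itself, but only the diagram has the
  arrow of a conclusion. A single arrow has no inner term, so nothing is deleted.\<close>

lemma inference_identity_iff:
  "inference 1 [Prop CA 1 1] (Prop X 1 1) J \<longleftrightarrow> X = CA \<and> J = (diagram (Prop CA 1 1), {})"
proof -
  have composes: "composes [e] S fs \<longleftrightarrow> S = {} \<and> fs = [e]" for e S fs
  proof
    assume "composes [e] S fs"
    then show "S = {} \<and> fs = [e]" by (induction rule: composes.induct) auto
  qed (auto intro: composes.refl)
  have concatenation: "concatenation [p] D \<longleftrightarrow> D \<in> {diagram p, dual_diagram p}" for p D
  proof
    assume "concatenation [p] D"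
    then show "D \<in> {diagram p, dual_diagram p}"
      by cases (auto simp: concatenation_not_Nil)
  qed (rule concatenation.single)
  show ?thesis
    by (cases J; cases X) (auto simp: inference_def concatenation composes)
qed

lemma UNIV_cform: "UNIV = {CA, CE, CI, CO}"
  using cform.exhaust by auto

lemma card_moods: "(\<Sum>X \<in> UNIV. card (moods X m a)) = 3 * (m + 1)\<^sup>2 - (m + 1)"
  by (simp add: UNIV_cform card_moods_CE card_moods_CI card_moods_CO power2_eq_square)

theorem theorem3:
  fixes n :: nat
  assumes "n \<ge> 1"
    and "infinite (UNIV :: 'a set)"
  shows "(\<forall>ps c. syllogism n ps c \<longrightarrow>
            (valid TYPE('a) ps c \<longleftrightarrow> (\<exists>J. inference n ps c J)) \<and>
            (\<forall>J J'. inference n ps c J \<longrightarrow> inference n ps c J' \<longrightarrow> J = J')) \<and>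
         card {(ps, c). syllogism n ps c \<and> valid TYPE('a) ps c} = 3 * n\<^sup>2 - n"
proof (intro conjI allI impI)
  fix ps c
  assume "syllogism n ps c"
  then obtain X where ps: "premisses n ps" and c: "c = Prop X 1 n"
    by (auto simp: syllogism_def)
  have identity: "n = 1" if "ps = [Prop CA 1 1]"
    using ps that assms(1) premisses_identity by blast
  show "valid TYPE('a) ps c \<longleftrightarrow> (\<exists>J. inference n ps c J)"
    using syllogism_iff_moods(1,2)[OF assms(2,1) ps, of X] identity valid_identity_iff[where ?'a = 'a, of X] inference_identity_iff[of X] c
    by (cases "ps = [Prop CA 1 1]") auto
  show "J = J'" if "inference n ps c J" "inference n ps c J'" for J J'
    using syllogism_iff_moods(3)[OF assms(2,1) ps, of X J J'] identity inference_identity_iff[of X] that c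
    by (cases "ps = [Prop CA 1 1]") auto
next
  let ?S = "{(ps, c). syllogism n ps c \<and> valid TYPE('a) ps c}"
  show "card ?S = 3 * n\<^sup>2 - n"
  proof (cases "n = 1")
    case True
    \<comment> \<open>The case of one term is listed by hand, since its law of identity has a
      premiss where \<open>moods\<close> has the empty list.\<close>
    have "?S = {([Prop CA 1 1], Prop CA 1 1), ([existence 1], Prop CI 1 1)}"
    proof -
      have "premisses 1 ps \<longleftrightarrow> ps = [Prop CA 1 1] \<or> ps = [existence 1]" for ps
        by (auto simp: premisses_iff)
      moreover have "valid TYPE('a) [existence 1] (Prop X 1 1) \<longleftrightarrow> X = CI" for X
        using syllogism_iff_moods(1)[OF assms(2), of 1 "[existence 1]" X]
        by (cases X) (auto simp: premisses_iff existence_def)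
      ultimately show ?thesis
        using True valid_identity_iff[where ?'a = 'a] by (auto simp: syllogism_def)
    qed
    with True show ?thesis by (simp add: existence_def)
  next
    case False
    with assms(1) have n: "2 \<le> n" by simp
    then have "ps \<noteq> [Prop CA 1 1]" if "premisses n ps" for ps
      using that premisses_identity[of n] assms(1) False by blast
    \<comment> \<open>Valid syllogisms correspond to pairs of a conclusion form and a member of
      \<open>moods\<close>, so the count is a sum over the four forms.\<close>
    then have "?S = (\<lambda>(X, ps). (ps, Prop X 1 n)) ` (SIGMA X : UNIV. moods X (n - 1) 1)"
      using syllogism_iff_moods(1)[OF assms(2,1)] moods_premisses[OF _ n]
      by (fastforce simp: syllogism_def image_iff)
    moreover have "inj_on (\<lambda>(X, ps). (ps, Prop X 1 n)) (SIGMA X : UNIV. moods X (n - 1) 1)"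
      by (auto simp: inj_on_def)
    ultimately have "card ?S = (\<Sum>X \<in> UNIV. card (moods X (n - 1) 1))"
      by (simp add: card_image card_SigmaI UNIV_cform)
    then show ?thesis
      using card_moods[of "n - 1" 1] n by simp
  qed
qed

end
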